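(* Let $f\colon\mathbb{R}^n\to\mathbb{R}$ be continuously differentiable and pseudoconvex, have a global minimizer, and have a Lipschitz continuous gradient with constant $L>0$, i.e. $\|\nabla f(x)-\nabla f(y)\|\le L\|x-y\|$ for all $x,y\in\mathbb{R}^n$. Let $\{x_k\}_{k\ge 0}$ be a sequence generated by the full-step regularized method (described in the context) with parameters $r\in[3,\infty)$, $\tau\in[0,\infty)$, $\sigma_{\max}\in[0,\infty)$ and symmetric matrices $\{Q_k\}$. Suppose that there are $\eta\in(0,1)$, a real number $a\ge 2\tau+\frac{L}{1-\eta}$, and a sequence $\{\psi_k\}\subseteq[0,\infty)$ with $\sum_{k=0}^\infty\psi_k<\infty$ such that, for all $k\ge 0$, $Q_k\succeq aI$ and $Q_{k+1}\preceq(1+\psi_k)Q_k$. Then all iterations belong to $\mathcal{S}:=\{k\ge0\colon x_{k+1}=x_k+s_k\}$, and $\lim_{k\to\infty}x_k=x^*$ for some minimizer $x^*$ of $f$.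
   Context: $\|\cdot\|$ is the Euclidean norm. A continuously differentiable $f$ is pseudoconvex if, for all $x,y\in\mathbb{R}^n$, $\nabla f(x)^T(y-x)\ge 0$ implies $f(y)\ge f(x)$. For symmetric matrices, $A\preceq B$ (equivalently $B \succeq A$) means $B-A$ is positive semidefinite. Full-step regularized method. Given $r\in[3,\infty)$, $\tau\in[0,\infty)$, $\sigma_{\max}\in[0,\infty)$ and a starting point $x_0\in\mathbb{R}^n$, at each iteration $k=0,1,\ldots$ one takes any $\sigma_k\in[0,\sigma_{\max}]$ and some symmetric matrix $Q_k\in\mathbb{R}^{n\times n}$, defines the model $$m_k(s)=f(x_k)+\nabla f(x_k)^Ts+\tfrac12 s^TQ_ks+\tfrac{\sigma_k}{r}\|s\|^r,$$ takes some $s_k\in\mathbb{R}^n$ with $\|\nabla m_k(s_k)\|\le\tau\|s_k\|\min\{\|s_k\|,1\}$, and sets $x_{k+1}=x_k+s_k$. *)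

theory Defs
  imports "HOL-Analysis.Analysis"
begin

(* gradient f x is unspecified where f is not differentiable. *)
definition gradient :: "('a::euclidean_space \<Rightarrow> real) \<Rightarrow> 'a \<Rightarrow> 'a" where
  "gradient f x = (THE D. GDERIV f x :> D)"

lemma gradient_eqI:
  assumes "GDERIV f x :> D"
  shows "gradient f x = D"
  unfolding gradient_def
proof (rule the_equality)
  show "GDERIV f x :> D" by (fact assms)
  fix D' assume "GDERIV f x :> D'"
  then have "(\<lambda>h. inner h D') = (\<lambda>h. inner h D)"
    using assms unfolding gderiv_def by (rule has_derivative_unique)
  then show "D' = D"
    by (metis inner_commute vector_eq_rdot)
qed

lemma GDERIV_gradient:
  fixes f :: "'a::euclidean_space \<Rightarrow> real"
  assumes "f differentiable (at x)"
  shows "GDERIV f x :> gradient f x"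
proof -
  obtain f' where f': "(f has_derivative f') (at x)"
    using assms unfolding differentiable_def by blast
  have "f' = (\<lambda>h. inner h (adjoint f' 1))"
    using adjoint_works[OF has_derivative_linear[OF f'], of _ 1] by auto
  then have "GDERIV f x :> adjoint f' 1"
    using f' unfolding gderiv_def by simp
  then show ?thesis
    using gradient_eqI by metis
qed

definition continuously_differentiable :: "('a::euclidean_space \<Rightarrow> real) \<Rightarrow> bool" where
  "continuously_differentiable f \<longleftrightarrow>
     (\<forall>x. f differentiable (at x)) \<and> continuous_on UNIV (gradient f)"

definition pseudoconvex :: "('a::euclidean_space \<Rightarrow> real) \<Rightarrow> bool" where
  "pseudoconvex f \<longleftrightarrow> (\<forall>x y. gradient f x \<bullet> (y - x) \<ge> 0 \<longrightarrow> f y \<ge> f x)"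

definition global_minimizer :: "('a \<Rightarrow> real) \<Rightarrow> 'a \<Rightarrow> bool" where
  "global_minimizer f z \<longleftrightarrow> (\<forall>y. f z \<le> f y)"

definition symmetric_matrix :: "real^'n^'n \<Rightarrow> bool" where
  "symmetric_matrix A \<longleftrightarrow> transpose A = A"

definition positive_semidefinite :: "real^'n^'n \<Rightarrow> bool" where
  "positive_semidefinite A \<longleftrightarrow> symmetric_matrix A \<and> (\<forall>v. 0 \<le> v \<bullet> (A *v v))"

(* Only meant for symmetric matrices; the order on the vector type itself is componentwise. *)
definition loewner_le :: "real^'n^'n \<Rightarrow> real^'n^'n \<Rightarrow> bool" (infix \<open>\<preceq>\<^sub>L\<close> 50) where
  "A \<preceq>\<^sub>L B \<longleftrightarrow> positive_semidefinite (B - A)"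

(* Since 0 powr r = 0, the regularization term vanishes at s = 0, as it should. *)
definition regularized_model ::
  "(real^'n \<Rightarrow> real) \<Rightarrow> real \<Rightarrow> real^'n \<Rightarrow> real^'n^'n \<Rightarrow> real \<Rightarrow> real^'n \<Rightarrow> real" where
  "regularized_model f r x Q \<sigma> s =
     f x + gradient f x \<bullet> s + 1 / 2 * (s \<bullet> (Q *v s)) + \<sigma> / r * norm s powr r"

(* The choices of sigma, Q and s at each iteration are arbitrary within their constraints,
   so the method is a property of the generated sequences rather than a function. *)
definition full_step_regularized_method ::
  "(real^'n \<Rightarrow> real) \<Rightarrow> real \<Rightarrow> real \<Rightarrow> real \<Rightarrow>
   (nat \<Rightarrow> real) \<Rightarrow> (nat \<Rightarrow> real^'n^'n) \<Rightarrow> (nat \<Rightarrow> real^'n) \<Rightarrow> (nat \<Rightarrow> real^'n) \<Rightarrow> bool" where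
  "full_step_regularized_method f r \<tau> \<sigma>max \<sigma> Q s x \<longleftrightarrow>
     (\<forall>k. \<sigma> k \<in> {0..\<sigma>max} \<and> symmetric_matrix (Q k) \<and>
          norm (gradient (regularized_model f r (x k) (Q k) (\<sigma> k)) (s k))
            \<le> \<tau> * norm (s k) * min (norm (s k)) 1 \<and>
          x (Suc k) = x k + s k)"

definition successful_iterations :: "(nat \<Rightarrow> real^'n) \<Rightarrow> (nat \<Rightarrow> real^'n) \<Rightarrow> nat set" where
  "successful_iterations s x = {k. x (Suc k) = x k + s k}"

end

theory Submission
  imports Defs
begin

text \<open>
  Stationarity of the model gives
  \<open>Q\<^sub>k s\<^sub>k = e\<^sub>k - \<nabla>f(x\<^sub>k) - \<sigma>\<^sub>k \<parallel>s\<^sub>k\<parallel>\<^bsup>r-2\<^esup> s\<^sub>k\<close> with a small error \<open>e\<^sub>k\<close>.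
  Together with the descent lemma this makes \<open>\<Sum> \<parallel>s\<^sub>k\<parallel>\<^sup>2\<close> and \<open>\<Sum> s\<^sub>k \<bullet> Q\<^sub>k s\<^sub>k\<close> finite.
  For a minimizer \<open>z\<close>, pseudoconvexity yields \<open>\<nabla>f(x\<^sub>k) \<bullet> (z - x\<^sub>k) \<le> 0\<close>, and so
  \<open>(x\<^sub>k - z) \<bullet> Q\<^sub>k (x\<^sub>k - z)\<close> is nonincreasing up to summable perturbations
  (variable-metric quasi-Fejer monotonicity), hence convergent.
  The iterates are therefore bounded, their gradients tend to zero, and every cluster point is a
  minimizer; taking \<open>z\<close> to be a cluster point identifies the limit.
\<close>

section \<open>Sequences with summable perturbations\<close>

text \<open>Rests on \<open>1 + t \<le> exp t\<close>. It serves twice: for the normalizing products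
  in the next convergence lemma, and for the growth of the matrices \<open>Q k\<close>.\<close>

lemma prod_one_plus_le_exp_suminf:
  fixes \<alpha> :: "nat \<Rightarrow> real"
  assumes "\<And>k. 0 \<le> \<alpha> k" and "summable \<alpha>"
  shows "(\<Prod>i<k. 1 + \<alpha> i) \<le> exp (suminf \<alpha>)"
proof -
  have "(\<Prod>i<k. 1 + \<alpha> i) \<le> (\<Prod>i<k. exp (\<alpha> i))"
    using assms(1) by (intro prod_mono) auto
  also have "\<dots> = exp (\<Sum>i<k. \<alpha> i)"
    by (simp add: exp_sum)
  also have "\<dots> \<le> exp (suminf \<alpha>)"
    using assms by (simp add: sum_le_suminf)
  finally show ?thesis .
qed

lemma prod_one_plus_ge_1:
  fixes \<alpha> :: "nat \<Rightarrow> real"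
  assumes "\<And>k. 0 \<le> \<alpha> k"
  shows "1 \<le> (\<Prod>i<k. 1 + \<alpha> i)"
  using assms by (intro prod_ge_1) auto

text \<open>Dividing by the partial products \<open>P\<close> absorbs the factors
  \<open>1 + \<alpha> k\<close>; subtracting the partial sums of \<open>\<beta>\<close> then leaves
  a nonincreasing sequence \<open>w\<close>, bounded below. As \<open>P\<close> and these sums
  converge, \<open>u\<close> can be recovered from \<open>w\<close> as a convergent
  sequence.\<close>

lemma quasi_decreasing_convergent:
  fixes u \<alpha> \<beta> :: "nat \<Rightarrow> real"
  assumes u: "\<And>k. 0 \<le> u k" and \<alpha>: "\<And>k. 0 \<le> \<alpha> k" and \<beta>: "\<And>k. 0 \<le> \<beta> k"
    and sum\<alpha>: "summable \<alpha>" and sum\<beta>: "summable \<beta>"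
    and step: "\<And>k. u (Suc k) \<le> (1 + \<alpha> k) * u k + \<beta> k"
  shows "convergent u"
proof -
  define P where "P k = (\<Prod>i<k. 1 + \<alpha> i)" for k
  define w where "w k = u k / P k - (\<Sum>i<k. \<beta> i)" for k
  have P1: "1 \<le> P k" for k
    unfolding P_def using \<alpha> by (rule prod_one_plus_ge_1)
  have PS: "P (Suc k) = (1 + \<alpha> k) * P k" for k
    unfolding P_def by simp
  have "incseq P"
    using mult_right_mono[OF _ order_trans[OF zero_le_one P1], of 1 "1 + \<alpha> _"] \<alpha>
    by (intro incseq_SucI) (simp add: PS)
  moreover have "\<forall>k. P k \<le> exp (suminf \<alpha>)"
    unfolding P_def using prod_one_plus_le_exp_suminf[OF \<alpha> sum\<alpha>] by blast
  ultimately have "convergent P"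
    using incseq_convergent[of P] convergent_def by blast
  have "w (Suc k) \<le> w k" for k
  proof -
    have pos: "0 < P k" "0 < P (Suc k)"
      using P1[of k] P1[of "Suc k"] by linarith+
    have "u (Suc k) / P (Suc k) \<le> ((1 + \<alpha> k) * u k + \<beta> k) / P (Suc k)"
      using step pos by (simp add: divide_right_mono)
    also have "\<dots> = u k / P k + \<beta> k / P (Suc k)"
      using pos \<alpha>[of k] by (simp add: PS add_divide_distrib add_nonneg_eq_0_iff)
    also have "\<beta> k / P (Suc k) \<le> \<beta> k"
      using \<beta>[of k] P1[of "Suc k"] pos by (simp add: divide_le_eq mult_le_cancel_left1)
    finally show ?thesis
      unfolding w_def by simp
  qed
  then have "decseq w"
    by (rule decseq_SucI)
  moreover have "\<forall>k. - suminf \<beta> \<le> w k"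
  proof
    fix k
    have "0 \<le> u k / P k"
      using u[of k] P1[of k] by simp
    moreover have "(\<Sum>i<k. \<beta> i) \<le> suminf \<beta>"
      using \<beta> sum\<beta> by (simp add: sum_le_suminf)
    ultimately show "- suminf \<beta> \<le> w k"
      unfolding w_def by linarith
  qed
  ultimately have "convergent w"
    using decseq_convergent[of w] convergent_def by blast
  moreover have "convergent (\<lambda>k. \<Sum>i<k. \<beta> i)"
    using sum\<beta> summable_iff_convergent by blast
  ultimately have "convergent (\<lambda>k. (w k + (\<Sum>i<k. \<beta> i)) * P k)"
    using \<open>convergent P\<close> by (intro convergent_mult convergent_add)
  moreover have "(w k + (\<Sum>i<k. \<beta> i)) * P k = u k" for k
    using P1[of k] unfolding w_def by simp
  ultimately show ?thesis
    by simp
qed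

lemma summable_decrements:
  fixes F b :: "nat \<Rightarrow> real"
  assumes b: "\<And>k. 0 \<le> b k" and le: "\<And>k. b k \<le> F k - F (Suc k)" and m: "\<And>k. m \<le> F k"
  shows "summable b"
proof (rule summableI_nonneg_bounded)
  show "0 \<le> b k" for k by (fact b)
  show "sum b {..<n} \<le> F 0 - m" for n
  proof -
    have "sum b {..<n} \<le> (\<Sum>k<n. F k - F (Suc k))"
      by (rule sum_mono) (rule le)
    also have "\<dots> = F 0 - F n"
      by (rule sum_lessThan_telescope')
    also have "\<dots> \<le> F 0 - m"
      using m by simp
    finally show ?thesis .
  qed
qed

section \<open>Symmetric positive semidefinite matrices\<close>

lemma symmetric_matrix_dot:
  fixes A :: "real^'n^'n"
  assumes "symmetric_matrix A"
  shows "v \<bullet> (A *v w) = (A *v v) \<bullet> w"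
  by (metis assms dot_lmul_matrix symmetric_matrix_def transpose_matrix_vector)

lemma loewner_leD:
  assumes "A \<preceq>\<^sub>L B"
  shows "v \<bullet> (A *v v) \<le> v \<bullet> (B *v v)"
  using assms unfolding loewner_le_def positive_semidefinite_def
  by (metis diff_ge_0_iff_ge inner_diff_right matrix_vector_mult_diff_rdistrib)

text \<open>The form is nonnegative at \<open>v - t *\<^sub>R (A *v v)\<close>, and
  \<open>t = 1 / M\<close> gives the best bound. This later upgrades convergence of the scalars
  \<open>s k \<bullet> (Q k *v s k)\<close> to that of the vectors
  \<open>Q k *v s k\<close>.\<close>

lemma psd_norm_matrix_vector_le:
  fixes A :: "real^'n^'n"
  assumes sym: "symmetric_matrix A" and "\<And>v. 0 \<le> v \<bullet> (A *v v)"
    and le: "\<And>v. v \<bullet> (A *v v) \<le> M * (norm v)\<^sup>2" and M: "0 < M"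
  shows "(norm (A *v v))\<^sup>2 \<le> M * (v \<bullet> (A *v v))"
proof -
  define w where "w = A *v v"
  define t where "t = 1 / M"
  have "0 \<le> (v - t *\<^sub>R w) \<bullet> (A *v (v - t *\<^sub>R w))"
    by fact
  also have "\<dots> = v \<bullet> w - 2 * t * (w \<bullet> w) + t\<^sup>2 * (w \<bullet> (A *v w))"
    using symmetric_matrix_dot[OF sym, of v w]
    by (simp add: matrix_vector_mult_diff_distrib matrix_vector_mult_scaleR inner_diff_left
        inner_diff_right w_def[symmetric] power2_eq_square inner_commute algebra_simps)
  also have "\<dots> \<le> v \<bullet> w - 2 * t * (w \<bullet> w) + t\<^sup>2 * (M * (norm w)\<^sup>2)"
    using le[of w] by (simp add: mult_left_mono)
  also have "\<dots> = v \<bullet> w - (norm w)\<^sup>2 / M"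
    using M by (simp add: t_def power2_norm_eq_inner[symmetric]) (simp add: power2_eq_square field_simps)
  finally show ?thesis
    using M unfolding w_def by (simp add: field_simps)
qed

lemma quadratic_form_expand:
  fixes A :: "real^'n^'n"
  assumes "symmetric_matrix A"
  shows "(y + s) \<bullet> (A *v (y + s)) = y \<bullet> (A *v y) + 2 * (y \<bullet> (A *v s)) + s \<bullet> (A *v s)"
proof -
  have "s \<bullet> (A *v y) = y \<bullet> (A *v s)"
    using symmetric_matrix_dot[OF assms, of s y] by (simp only: inner_commute)
  then show ?thesis
    by (simp add: matrix_vector_right_distrib inner_add_left inner_add_right)
qed

section \<open>Gradients\<close>

text \<open>The claim is \<open>\<phi> 1 \<le> \<phi> 0\<close> along the segment from
  \<open>x\<close> to \<open>x + s\<close>; the Lipschitz bound and Cauchy-Schwarz make the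
  derivative of \<open>\<phi>\<close> nonpositive.\<close>

lemma descent_lemma:
  fixes f :: "'a::euclidean_space \<Rightarrow> real"
  assumes diff: "\<And>x. f differentiable (at x)" and lip: "L-lipschitz_on UNIV (gradient f)"
  shows "f (x + s) \<le> f x + gradient f x \<bullet> s + L / 2 * (norm s)\<^sup>2"
proof -
  define \<phi> where "\<phi> t = f (x + t *\<^sub>R s) - t * (gradient f x \<bullet> s) - L / 2 * t\<^sup>2 * (norm s)\<^sup>2" for t
  have "\<exists>y. (\<phi> has_real_derivative y) (at t) \<and> y \<le> 0" if "0 \<le> t" "t \<le> 1" for t
  proof (intro exI conjI)
    have "(f has_derivative (\<lambda>h. h \<bullet> gradient f (x + t *\<^sub>R s))) (at (x + t *\<^sub>R s))"
      using GDERIV_gradient[OF diff] unfolding gderiv_def .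
    moreover have "((\<lambda>t. x + t *\<^sub>R s) has_derivative (\<lambda>h. h *\<^sub>R s)) (at t)"
      by (auto intro!: derivative_eq_intros)
    ultimately have "((\<lambda>t. f (x + t *\<^sub>R s)) has_derivative
        (\<lambda>h. (h *\<^sub>R s) \<bullet> gradient f (x + t *\<^sub>R s))) (at t)"
      using has_derivative_compose[of "\<lambda>t. x + t *\<^sub>R s"] by blast
    then have "((\<lambda>t. f (x + t *\<^sub>R s)) has_real_derivative (gradient f (x + t *\<^sub>R s) \<bullet> s)) (at t)"
      unfolding has_field_derivative_def
      by (rule has_derivative_eq_rhs) (auto simp: inner_commute)
    then show "(\<phi> has_real_derivative
        (gradient f (x + t *\<^sub>R s) \<bullet> s - gradient f x \<bullet> s - L * t * (norm s)\<^sup>2)) (at t)"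
      unfolding \<phi>_def by (auto intro!: derivative_eq_intros)
    have "(gradient f (x + t *\<^sub>R s) - gradient f x) \<bullet> s
        \<le> norm (gradient f (x + t *\<^sub>R s) - gradient f x) * norm s"
      by (rule norm_cauchy_schwarz)
    also have "\<dots> \<le> (L * (t * norm s)) * norm s"
      using lipschitz_onD[OF lip, of "x + t *\<^sub>R s" x] that
      by (intro mult_right_mono) (auto simp: dist_norm)
    finally show "gradient f (x + t *\<^sub>R s) \<bullet> s - gradient f x \<bullet> s - L * t * (norm s)\<^sup>2 \<le> 0"
      by (simp add: inner_diff_left power2_eq_square algebra_simps)
  qed
  then have "\<phi> 1 \<le> \<phi> 0"
    using DERIV_nonpos_imp_nonincreasing[of 0 1 \<phi>] by simp
  then show ?thesis
    unfolding \<phi>_def by simp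
qed

text \<open>Away from the origin this is the chain rule. At the origin, where the norm is not
  differentiable, the difference quotient has size \<open>norm y powr (r - 1)\<close>, which tends
  to 0 because \<open>r > 1\<close>.\<close>

lemma GDERIV_norm_powr:
  fixes s :: "'a::euclidean_space"
  assumes "r > 1"
  shows "GDERIV (\<lambda>s. norm s powr r) s :> (r * norm s powr (r - 2)) *\<^sub>R s"
proof (cases "s = 0")
  case True
  have "((\<lambda>y::'a. norm y powr (r - 1)) \<longlongrightarrow> 0 powr (r - 1)) (at 0)"
    using assms by (intro tendsto_powr2 tendsto_norm_zero tendsto_const) (auto intro: tendsto_ident_at)
  \<comment> \<open>At \<open>y = 0\<close> both sides are 0, as \<open>0 powr (r - 1)\<close> and
    division by zero are 0.\<close>
  moreover have "norm y powr (r - 1) = norm (norm y powr r) / norm y" for y :: 'a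
    by (cases "y = 0") (auto simp: powr_diff)
  ultimately have "((\<lambda>s::'a. norm s powr r) has_derivative (\<lambda>_. 0)) (at 0)"
    using assms unfolding has_derivative_at by (simp add: bounded_linear_zero)
  then show ?thesis
    using True unfolding gderiv_def by simp
next
  case False
  have "((\<lambda>s. norm s powr r) has_derivative
      (\<lambda>h. norm s powr r * (0 * ln (norm s) + (h \<bullet> sgn s) * r / norm s))) (at s)"
    using False by (auto intro!: derivative_eq_intros has_derivative_norm simp: inner_commute)
  moreover have "norm s powr r * (0 * ln (norm s) + (h \<bullet> sgn s) * r / norm s)
      = h \<bullet> ((r * norm s powr (r - 2)) *\<^sub>R s)" for h
    using False by (simp add: powr_diff sgn_div_norm power2_eq_square field_simps)
  ultimately show ?thesis
    unfolding gderiv_def by simp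
qed

lemma gradient_regularized_model:
  fixes Q :: "real^'n^'n"
  assumes "symmetric_matrix Q" and "r > 1"
  shows "gradient (regularized_model f r x Q \<sigma>) s
    = gradient f x + Q *v s + (\<sigma> * norm s powr (r - 2)) *\<^sub>R s"
proof (rule gradient_eqI)
  have norm: "((\<lambda>s. norm s powr r) has_derivative (\<lambda>h. h \<bullet> ((r * norm s powr (r - 2)) *\<^sub>R s))) (at s)"
    using GDERIV_norm_powr[OF assms(2), of s] unfolding gderiv_def .
  have mult: "((\<lambda>s. Q *v s) has_derivative (\<lambda>h. Q *v h)) (at s)"
    by (intro bounded_linear_imp_has_derivative matrix_vector_mul_bounded_linear)
  have "(regularized_model f r x Q \<sigma> has_derivative
      (\<lambda>h. gradient f x \<bullet> h + 1 / 2 * (s \<bullet> (Q *v h) + h \<bullet> (Q *v s))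
        + \<sigma> / r * (h \<bullet> ((r * norm s powr (r - 2)) *\<^sub>R s)))) (at s)"
    unfolding regularized_model_def[abs_def]
    by (rule derivative_eq_intros norm mult refl)+ (simp add: fun_eq_iff)
  then show "GDERIV (regularized_model f r x Q \<sigma>) s :>
      gradient f x + Q *v s + (\<sigma> * norm s powr (r - 2)) *\<^sub>R s"
    unfolding gderiv_def
  proof (rule has_derivative_eq_rhs, intro ext)
    fix h
    have "s \<bullet> (Q *v h) = h \<bullet> (Q *v s)"
      using symmetric_matrix_dot[OF assms(1), of s h] by (simp only: inner_commute)
    then show "gradient f x \<bullet> h + 1 / 2 * (s \<bullet> (Q *v h) + h \<bullet> (Q *v s))
        + \<sigma> / r * (h \<bullet> ((r * norm s powr (r - 2)) *\<^sub>R s))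
      = h \<bullet> (gradient f x + Q *v s + (\<sigma> * norm s powr (r - 2)) *\<^sub>R s)"
      using assms(2) by (simp add: inner_add_right inner_commute[of h "gradient f x"])
  qed
qed

text \<open>If the product were positive, pseudoconvexity would give \<open>f x \<le> f z\<close>,
  so \<open>x\<close> itself would be a minimizer and its gradient would vanish.\<close>

lemma pseudoconvex_gradient_minimizer_le:
  assumes "pseudoconvex f" "global_minimizer f z" "\<And>x. f differentiable (at x)"
  shows "gradient f x \<bullet> (z - x) \<le> 0"
proof (rule ccontr)
  assume pos: "\<not> gradient f x \<bullet> (z - x) \<le> 0"
  then have "f x \<le> f z"
    using assms(1) unfolding pseudoconvex_def by (meson linear)
  then have "f x \<le> f y" for y
    using assms(2) unfolding global_minimizer_def by (meson order_trans)
  then have "(\<lambda>h. h \<bullet> gradient f x) = (\<lambda>h. 0)"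
    using GDERIV_gradient[OF assms(3), of x] unfolding gderiv_def
    by (intro differential_zero_maxmin[of x UNIV f]) auto
  with pos show False
    by (metis inner_commute linear)
qed

section \<open>Convergence of the method\<close>

theorem theorem3:
  fixes f :: "real^'n \<Rightarrow> real"
    and L r \<tau> \<sigma>max \<eta> a :: real
    and \<sigma> \<psi> :: "nat \<Rightarrow> real"
    and Q :: "nat \<Rightarrow> real^'n^'n"
    and s x :: "nat \<Rightarrow> real^'n"
  assumes "continuously_differentiable f"
    and "pseudoconvex f"
    and "\<exists>z. global_minimizer f z"
    and "L > 0"
    and "lipschitz_on L UNIV (gradient f)"
    and "r \<ge> 3" and "\<tau> \<ge> 0" and "\<sigma>max \<ge> 0"
    and "full_step_regularized_method f r \<tau> \<sigma>max \<sigma> Q s x"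
    and "0 < \<eta>" and "\<eta> < 1"
    and "a \<ge> 2 * \<tau> + L / (1 - \<eta>)"
    and "\<And>k. \<psi> k \<ge> 0"
    and "summable \<psi>"
    and "\<And>k. a *\<^sub>R mat 1 \<preceq>\<^sub>L Q k"
    and "\<And>k. Q (Suc k) \<preceq>\<^sub>L (1 + \<psi> k) *\<^sub>R Q k"
  shows "(\<forall>k. k \<in> successful_iterations s x) \<and>
         (\<exists>xstar. global_minimizer f xstar \<and> x \<longlonglongrightarrow> xstar)"
proof -

  \<comment> \<open>Residual of the model and bounds on the metrics\<close>
  have diff: "f differentiable (at y)" and cont: "continuous_on UNIV (gradient f)" for y
    using assms(1) unfolding continuously_differentiable_def by auto
  have \<sigma>: "0 \<le> \<sigma> k" "\<sigma> k \<le> \<sigma>max" and sym: "symmetric_matrix (Q k)"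
    and xS: "x (Suc k) = x k + s k" for k
    using assms(9) unfolding full_step_regularized_method_def by auto
  define e where "e k = gradient (regularized_model f r (x k) (Q k) (\<sigma> k)) (s k)" for k
  have e_eq: "e k = gradient f (x k) + Q k *v s k + (\<sigma> k * norm (s k) powr (r - 2)) *\<^sub>R s k" for k
    unfolding e_def using sym assms(6) by (intro gradient_regularized_model) auto
  have e: "norm (e k) \<le> \<tau> * norm (s k) * min (norm (s k)) 1" for k
    using assms(9) unfolding full_step_regularized_method_def e_def by blast
  \<comment> \<open>The two arguments of \<open>min\<close> give a linear and a quadratic bound: the
    linear one serves the descent estimate, the quadratic one makes the errors summable.\<close>
  have e1: "norm (e k) \<le> \<tau> * norm (s k)" for k
  proof -
    have "\<tau> * norm (s k) * min (norm (s k)) 1 \<le> \<tau> * norm (s k) * 1"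
      using assms(7) by (intro mult_left_mono) auto
    then show ?thesis using e[of k] by simp
  qed
  have e2: "norm (e k) \<le> \<tau> * (norm (s k))\<^sup>2" for k
  proof -
    have "\<tau> * norm (s k) * min (norm (s k)) 1 \<le> \<tau> * norm (s k) * norm (s k)"
      using assms(7) by (intro mult_left_mono) auto
    then show ?thesis using e[of k] by (simp add: power2_eq_square)
  qed
  have "L \<le> L / (1 - \<eta>)"
    using assms(4,10,11) by (simp add: field_simps)
  then have a: "2 * \<tau> + L \<le> a"
    using assms(12) by linarith
  then have a0: "0 < a"
    using assms(4,7) by linarith
  have Qlow: "a * (norm v)\<^sup>2 \<le> v \<bullet> (Q k *v v)" for k v
    using loewner_leD[OF assms(15)[of k], of v]
    by (simp add: scaleR_matrix_vector_assoc[symmetric] power2_norm_eq_inner)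
  have Qpos: "0 \<le> v \<bullet> (Q k *v v)" for k v
    using Qlow[of v k] a0 by (meson mult_nonneg_nonneg order_less_imp_le order_trans zero_le_power2)
  have Qstep: "v \<bullet> (Q (Suc k) *v v) \<le> (1 + \<psi> k) * (v \<bullet> (Q k *v v))" for k v
    using loewner_leD[OF assms(16)[of k], of v] by (simp add: scaleR_matrix_vector_assoc[symmetric])

  \<comment> \<open>Uniform upper bound on the metrics\<close>
  obtain M where M: "0 < M" and Qup: "\<And>k v. v \<bullet> (Q k *v v) \<le> M * (norm v)\<^sup>2"
  proof -
    obtain K where K: "0 < K" "\<And>v. norm (Q 0 *v v) \<le> norm v * K"
      using bounded_linear.pos_bounded[OF matrix_vector_mul_bounded_linear[of "Q 0"]] by blast
    have "v \<bullet> (Q k *v v) \<le> (exp (suminf \<psi>) * K) * (norm v)\<^sup>2" for k v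
    proof -
      have "v \<bullet> (Q k *v v) \<le> (\<Prod>i<k. 1 + \<psi> i) * (v \<bullet> (Q 0 *v v))"
      proof (induction k)
        case (Suc k)
        have "v \<bullet> (Q (Suc k) *v v) \<le> (1 + \<psi> k) * (v \<bullet> (Q k *v v))"
          by (rule Qstep)
        also have "\<dots> \<le> (1 + \<psi> k) * ((\<Prod>i<k. 1 + \<psi> i) * (v \<bullet> (Q 0 *v v)))"
          using Suc assms(13)[of k] by (intro mult_left_mono) auto
        finally show ?case by (simp add: mult_ac)
      qed simp
      also have "\<dots> \<le> exp (suminf \<psi>) * (v \<bullet> (Q 0 *v v))"
        by (rule mult_right_mono[OF prod_one_plus_le_exp_suminf[OF assms(13,14)] Qpos])
      also have "\<dots> \<le> exp (suminf \<psi>) * (norm v * (norm v * K))"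
        using order_trans[OF norm_cauchy_schwarz mult_left_mono[OF K(2)[of v] norm_ge_zero]]
        by (intro mult_left_mono) auto
      finally show ?thesis by (simp add: power2_eq_square mult_ac)
    qed
    then show thesis using K(1) that[of "exp (suminf \<psi>) * K"] by simp
  qed

  \<comment> \<open>Descent and summability of the steps\<close>
  define q where "q k = s k \<bullet> (Q k *v s k)" for k
  have es: "e k \<bullet> s k \<le> \<tau> * (norm (s k))\<^sup>2" for k
  proof -
    have "e k \<bullet> s k \<le> norm (e k) * norm (s k)" by (rule norm_cauchy_schwarz)
    also have "\<dots> \<le> \<tau> * norm (s k) * norm (s k)" by (intro mult_right_mono e1) simp
    finally show ?thesis by (simp add: power2_eq_square)
  qed
  \<comment> \<open>The gradient in the descent lemma is eliminated through \<open>e_eq\<close>; the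
    regularization term enters with a favorable sign and is dropped.\<close>
  have descent: "q k \<le> f (x k) - f (x (Suc k)) + (\<tau> + L / 2) * (norm (s k))\<^sup>2" for k
  proof -
    have "f (x k + s k) \<le> f (x k) + gradient f (x k) \<bullet> s k + L / 2 * (norm (s k))\<^sup>2"
      by (rule descent_lemma[OF diff assms(5)])
    moreover have "gradient f (x k) \<bullet> s k
        = e k \<bullet> s k - q k - \<sigma> k * norm (s k) powr (r - 2) * (s k \<bullet> s k)"
      unfolding e_eq q_def by (simp add: inner_add_left inner_commute[of "Q k *v s k" "s k"])
    moreover have "0 \<le> \<sigma> k * norm (s k) powr (r - 2) * (s k \<bullet> s k)"
      using \<sigma> by simp
    ultimately show ?thesis
      using es[of k] by (simp add: xS algebra_simps)
  qed
  \<comment> \<open>Since \<open>q k\<close> is at least \<open>a * (norm (s k))\<^sup>2\<close>, it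
    absorbs the error term of \<open>descent\<close> and leaves \<open>L / 2\<close> to
    spare.\<close>
  have decr: "L / 2 * (norm (s k))\<^sup>2 \<le> f (x k) - f (x (Suc k))" for k
  proof -
    have "L / 2 + (\<tau> + L / 2) \<le> a"
      using a assms(7) by simp
    then have "(L / 2 + (\<tau> + L / 2)) * (norm (s k))\<^sup>2 \<le> a * (norm (s k))\<^sup>2"
      by (rule mult_right_mono) simp
    also have "\<dots> \<le> q k"
      unfolding q_def by (rule Qlow)
    finally show ?thesis
      using descent[of k] by (simp add: algebra_simps)
  qed
  obtain z0 where "global_minimizer f z0" using assms(3) by blast
  then have low: "f z0 \<le> f y" for y unfolding global_minimizer_def by blast
  have sum_decr: "summable (\<lambda>k. f (x k) - f (x (Suc k)))"
  proof (rule summable_decrements[where F = "\<lambda>k. f (x k)" and m = "f z0"])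
    show "0 \<le> f (x k) - f (x (Suc k))" for k
      using decr[of k] assms(4) by (meson mult_nonneg_nonneg half_gt_zero less_imp_le order_trans zero_le_power2)
  qed (auto intro: low)
  have "summable (\<lambda>k. L / 2 * (norm (s k))\<^sup>2)"
    using assms(4) decr by (intro summable_comparison_test'[OF sum_decr, of 0]) auto
  then have sums: "summable (\<lambda>k. (norm (s k))\<^sup>2)"
    using assms(4) by (subst (asm) summable_cmult_iff) auto
  have sumq: "summable q"
    using descent Qpos[of "s k" k for k, folded q_def]
    by (intro summable_comparison_test'[OF summable_add[OF sum_decr summable_mult[OF sums, of "\<tau> + L / 2"]], of 0])
      auto
  have s0: "(\<lambda>k. norm (s k)) \<longlonglongrightarrow> 0"
    using tendsto_real_sqrt[OF summable_LIMSEQ_zero[OF sums]] by simp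
  obtain B where B: "norm (s k) \<le> B" for k
    using convergent_imp_bounded[OF s0] unfolding bounded_iff by auto
  \<comment> \<open>With \<open>r \<ge> 3\<close> the power \<open>r - 3\<close> is monotone, so the
    bound \<open>B\<close> on the steps makes the regularization term quadratic in
    \<open>norm (s k)\<close>, hence summable.\<close>
  define S where "S = B powr (r - 3)"
  have S0: "0 \<le> S" unfolding S_def by simp
  have reg: "norm ((\<sigma> k * norm (s k) powr (r - 2)) *\<^sub>R s k) \<le> \<sigma>max * S * (norm (s k))\<^sup>2" for k
  proof (cases "s k = 0")
    case False
    have "norm (s k) powr (r - 2) * norm (s k) = norm (s k) powr (r - 3) * (norm (s k))\<^sup>2"
    proof -
      have "norm (s k) powr (r - 2) = norm (s k) powr (r - 3) * norm (s k) powr 1"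
        unfolding powr_add[symmetric] by simp
      then show ?thesis by (simp add: power2_eq_square)
    qed
    moreover have "norm (s k) powr (r - 3) \<le> S"
      unfolding S_def using assms(6) B by (intro powr_mono2) auto
    moreover have "\<sigma> k * norm (s k) powr (r - 3) \<le> \<sigma>max * S"
      using \<sigma>[of k] calculation(2) by (intro mult_mono) auto
    then have "\<sigma> k * norm (s k) powr (r - 3) * (norm (s k))\<^sup>2 \<le> \<sigma>max * S * (norm (s k))\<^sup>2"
      by (rule mult_right_mono) simp
    ultimately show ?thesis
      using \<sigma>[of k] by (simp add: mult.assoc)
  qed simp

  \<comment> \<open>Quasi-Fejer monotonicity in the variable metric\<close>
  have fejer: "convergent (\<lambda>k. (x k - z) \<bullet> (Q k *v (x k - z)))" if z: "global_minimizer f z" for z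
  proof -
    define D where "D k = (x k - z) \<bullet> (Q k *v (x k - z))" for k
    define c where "c = \<tau> + \<sigma>max * S"
    define \<Psi> where "\<Psi> = suminf \<psi>"
    define n where "n k = (norm (s k))\<^sup>2" for k
    have \<Psi>: "\<psi> k \<le> \<Psi>" for k
      unfolding \<Psi>_def using assms(13,14) sum_le_suminf[of \<psi> "{k}"] by auto
    have \<Psi>0: "0 \<le> \<Psi>"
      using \<Psi>[of 0] assms(13)[of 0] by linarith
    have c0: "0 \<le> c"
      unfolding c_def using assms(7,8) S0 by simp
    have n0: "0 \<le> n k" for k unfolding n_def by simp
    have D0: "0 \<le> D k" and q0: "0 \<le> q k" for k unfolding D_def q_def by (rule Qpos)+
    \<comment> \<open>Only the point moves here; the metric stays \<open>Q k\<close>. The change to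
      \<open>Q (Suc k)\<close> is charged to \<open>Qstep\<close> below.\<close>
    have step: "(x (Suc k) - z) \<bullet> (Q k *v (x (Suc k) - z)) \<le> (1 + c * n k / a) * D k + (c * n k + q k)" for k
    proof -
      define y where "y = x k - z"
      define R where "R = (\<sigma> k * norm (s k) powr (r - 2)) *\<^sub>R s k"
      \<comment> \<open>Solving \<open>e_eq\<close> for \<open>Q k *v s k\<close> isolates the
        gradient term, nonpositive because \<open>z\<close> is a minimizer; the rest is of second
        order in the step.\<close>
      have "y \<bullet> (Q k *v s k) = y \<bullet> (e k - R) + gradient f (x k) \<bullet> (z - x k)"
        unfolding e_eq y_def R_def by (simp add: inner_diff_right inner_add_right inner_diff_left inner_commute)
      also have "\<dots> \<le> y \<bullet> (e k - R)"
        using pseudoconvex_gradient_minimizer_le[OF assms(2) z diff, of "x k"] by simp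
      also have "\<dots> \<le> norm y * norm (e k - R)"
        by (rule norm_cauchy_schwarz)
      also have "\<dots> \<le> norm y * (c * n k)"
      proof (rule mult_left_mono)
        show "norm (e k - R) \<le> c * n k"
          using norm_triangle_ineq4[of "e k" R] e2[of k] reg[of k]
          unfolding c_def n_def R_def by (simp add: algebra_simps)
      qed simp
      finally have 1: "y \<bullet> (Q k *v s k) \<le> norm y * (c * n k)" .
      \<comment> \<open>This splits the factor linear in \<open>norm y\<close> into a constant,
        which becomes an additive perturbation, and a multiple of \<open>D k\<close>, which becomes
        a multiplicative one.\<close>
      have "2 * norm y \<le> 1 + (norm y)\<^sup>2"
        using sum_squares_bound[of 1 "norm y"] by simp
      also have "(norm y)\<^sup>2 \<le> D k / a"
        using Qlow[of y k] a0 unfolding D_def y_def by (simp add: pos_le_divide_eq mult.commute)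
      finally have "2 * norm y * (c * n k) \<le> (1 + D k / a) * (c * n k)"
        using c0 n0 by (intro mult_right_mono) auto
      moreover have "(x (Suc k) - z) \<bullet> (Q k *v (x (Suc k) - z)) = D k + 2 * (y \<bullet> (Q k *v s k)) + q k"
        using quadratic_form_expand[OF sym, of y "s k" k]
        unfolding D_def q_def y_def xS by (simp add: algebra_simps)
      ultimately show ?thesis
        using 1 by (simp add: algebra_simps)
    qed
    have "convergent D"
    proof (rule quasi_decreasing_convergent)
      show "summable (\<lambda>k. \<psi> k + (1 + \<Psi>) * (c / a) * n k)"
        unfolding n_def by (intro summable_add summable_mult assms(14) sums)
      show "summable (\<lambda>k. (1 + \<Psi>) * (c * n k + q k))"
        unfolding n_def by (intro summable_add summable_mult sums sumq)
      show "D (Suc k) \<le> (1 + (\<psi> k + (1 + \<Psi>) * (c / a) * n k)) * D k + (1 + \<Psi>) * (c * n k + q k)" for k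
      proof -
        have p: "0 \<le> c / a * n k * D k" "0 \<le> c * n k + q k"
          using c0 a0 n0 D0 q0 by simp_all
        have "D (Suc k) \<le> (1 + \<psi> k) * ((1 + c * n k / a) * D k + (c * n k + q k))"
          using Qstep[of "x (Suc k) - z" k] mult_left_mono[OF step[of k], of "1 + \<psi> k"] assms(13)[of k]
          unfolding D_def by linarith
        also have "\<dots> = (1 + \<psi> k) * D k + (1 + \<psi> k) * (c / a * n k * D k + (c * n k + q k))"
          by (simp add: algebra_simps)
        \<comment> \<open>Replacing \<open>\<psi> k\<close> by its bound \<open>\<Psi>\<close> in
          the second summand avoids products of perturbations.\<close>
        also have "\<dots> \<le> (1 + \<psi> k) * D k + (1 + \<Psi>) * (c / a * n k * D k + (c * n k + q k))"
          using \<Psi>[of k] p by (intro add_left_mono mult_right_mono) auto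
        finally show ?thesis by (simp add: algebra_simps)
      qed
    qed (use D0 q0 n0 c0 a0 \<Psi>0 assms(13) in auto)
    then show ?thesis unfolding D_def .
  qed

  \<comment> \<open>A cluster point that is a minimizer\<close>
  have "bounded (range x)"
  proof -
    obtain C where C: "(x k - z0) \<bullet> (Q k *v (x k - z0)) \<le> C" for k
    proof -
      have "Bseq (\<lambda>k. (x k - z0) \<bullet> (Q k *v (x k - z0)))"
        using fejer[OF \<open>global_minimizer f z0\<close>] by (rule convergent_imp_Bseq)
      then show thesis using that unfolding Bseq_def by (auto simp: abs_le_iff)
    qed
    have "norm (x k - z0) \<le> sqrt (C / a)" for k
      using order_trans[OF Qlow C, of k] a0
      by (intro real_le_rsqrt) (simp add: field_simps)
    then have "dist z0 (x k) \<le> sqrt (C / a)" for k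
      by (simp add: dist_norm norm_minus_commute)
    then show ?thesis unfolding bounded_def by blast
  qed
  then obtain xs \<rho> where \<rho>: "strict_mono \<rho>" and lim: "(x \<circ> \<rho>) \<longlonglongrightarrow> xs"
    using bounded_imp_convergent_subsequence by blast
  have Qs_lim: "(\<lambda>k. Q k *v s k) \<longlonglongrightarrow> 0"
  proof (rule Lim_null_comparison)
    show "(\<lambda>k. sqrt (M * q k)) \<longlonglongrightarrow> 0"
      using tendsto_real_sqrt[OF tendsto_mult_right_zero[OF summable_LIMSEQ_zero[OF sumq], of M]] by simp
    show "\<forall>\<^sub>F k in sequentially. norm (Q k *v s k) \<le> sqrt (M * q k)"
      using psd_norm_matrix_vector_le[OF sym Qpos Qup M] unfolding q_def
      by (intro always_eventually allI real_le_rsqrt) auto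
  qed
  have e_lim: "e \<longlonglongrightarrow> 0"
    by (rule Lim_null_comparison[OF always_eventually tendsto_mult_right_zero[OF s0]]) (use e1 in blast)
  have reg_lim: "(\<lambda>k. (\<sigma> k * norm (s k) powr (r - 2)) *\<^sub>R s k) \<longlonglongrightarrow> 0"
    by (rule Lim_null_comparison[OF always_eventually
          tendsto_mult_right_zero[OF summable_LIMSEQ_zero[OF sums]]]) (use reg in blast)
  \<comment> \<open>By \<open>e_eq\<close> the gradient is a combination of three null
    sequences.\<close>
  have "(\<lambda>k. gradient f (x k)) \<longlonglongrightarrow> 0"
    using tendsto_diff[OF tendsto_diff[OF e_lim Qs_lim] reg_lim] unfolding e_eq by simp
  then have "((\<lambda>k. gradient f (x k)) \<circ> \<rho>) \<longlonglongrightarrow> 0"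
    using \<rho> by (rule LIMSEQ_subseq_LIMSEQ)
  moreover have "(\<lambda>k. gradient f ((x \<circ> \<rho>) k)) \<longlonglongrightarrow> gradient f xs"
    using continuous_on_tendsto_compose[OF cont lim] by simp
  ultimately have "gradient f xs = 0"
    using LIMSEQ_unique by (auto simp: o_def)
  then have min: "global_minimizer f xs"
    using assms(2) unfolding pseudoconvex_def global_minimizer_def by simp

  \<comment> \<open>Convergence of the whole sequence\<close>
  define D where "D k = (x k - xs) \<bullet> (Q k *v (x k - xs))" for k
  obtain l where l: "D \<longlonglongrightarrow> l"
    using fejer[OF min] unfolding D_def convergent_def by blast
  \<comment> \<open>The uniform upper bound \<open>M\<close> carries convergence of the subsequence
    over to \<open>D\<close>. As all of \<open>D\<close> converges, its limit is 0, and the lower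
    bound \<open>a\<close> carries this back to \<open>x\<close>.\<close>
  have "(D \<circ> \<rho>) \<longlonglongrightarrow> 0"
  proof (rule Lim_null_comparison)
    have "(\<lambda>k. M * (norm ((x \<circ> \<rho>) k - xs))\<^sup>2) \<longlonglongrightarrow> M * (norm (xs - xs))\<^sup>2"
      by (intro tendsto_intros lim)
    then show "(\<lambda>k. M * (norm ((x \<circ> \<rho>) k - xs))\<^sup>2) \<longlonglongrightarrow> 0" by simp
    show "\<forall>\<^sub>F k in sequentially. norm ((D \<circ> \<rho>) k) \<le> M * (norm ((x \<circ> \<rho>) k - xs))\<^sup>2"
      using Qup Qpos unfolding D_def by (intro always_eventually) auto
  qed
  then have "D \<longlonglongrightarrow> 0"
    using l LIMSEQ_subseq_LIMSEQ[OF l \<rho>] LIMSEQ_unique by blast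
  then have Dlim: "(\<lambda>k. sqrt (D k / a)) \<longlonglongrightarrow> 0"
    using tendsto_real_sqrt[OF tendsto_divide_zero] by fastforce
  have "(\<lambda>k. x k - xs) \<longlonglongrightarrow> 0"
  proof (rule Lim_null_comparison[OF always_eventually Dlim], intro allI)
    show "norm (x k - xs) \<le> sqrt (D k / a)" for k
      using Qlow[of "x k - xs" k] a0 unfolding D_def
      by (intro real_le_rsqrt) (simp add: field_simps)
  qed
  then have "x \<longlonglongrightarrow> xs"
    by (rule LIM_zero_cancel)
  with min xS show ?thesis
    unfolding successful_iterations_def by auto
qed

end
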